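(* Let $\mathcal{M}=(E,\mathcal{I})$ be a matroid of rank $r$, unknown to the algorithm, whose elements arrive in an adversarial order $e_1,\dots,e_n$ with adversarially chosen non-negative weights $\omega:E\to W$ (revealed on arrival; each element must be irrevocably accepted or rejected, the accepted set always independent; only subsets of already arrived elements can be queried for independence). Let $e_1^*$ and $e_2^*$ be the largest and second largest non-loop elements with respect to $\omega$, and suppose the algorithm is given a number $L$ with $\omega(e_2^* )<L<\omega(e_1^* )$. Consider the following algorithm: (1) With probability $1/2$, select the (first) arriving non-loop element with weight above $L$ and return it. (2) Otherwise set $\mathrm{ALG}=\emptyset$, $r^*=2$, $w^*=L/2$; for each arriving element $e_i$: if $\omega(e_i)>w^*$ and $\mathrm{ALG}\cup\{e_i\}$ is independent, add $e_i$ to $\mathrm{ALG}$; then if $\mathrm{rank}(\{e_1,\dots,e_i\})\ge r^*$, with probability $\frac{1}{\log(2r^* )}$ set $w^*=L/(2r^* )$, and set $r^*=2r^*$. Return $\mathrm{ALG}$. Then $$\mathbb{E}[w(\mathrm{ALG}(\omega))]\ \ge\ \frac{1}{16\log r}\,w(\mathrm{OPT}(\omega)),$$ where the expectation is over the randomness of the algorithm and $\mathrm{OPT}(\omega)$ is a maximum-weight independent set.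
   Context: $w(S)=\sum_{e\in S}\omega(e)$; $\log$ is base 2. A loop is an element $e$ with $\{e\}$ dependent. *)

theory Defs
  imports "HOL-Probability.Probability"
begin

locale matroid =
  fixes E :: "'a set" and \<I> :: "'a set set"
  assumes finite_ground: "finite E"
    and indep_subset_ground: "X \<in> \<I> \<Longrightarrow> X \<subseteq> E"
    and indep_empty: "{} \<in> \<I>"
    and indep_hereditary: "X \<in> \<I> \<Longrightarrow> Y \<subseteq> X \<Longrightarrow> Y \<in> \<I>"
    and indep_augment:
      "X \<in> \<I> \<Longrightarrow> Y \<in> \<I> \<Longrightarrow> card X < card Y \<Longrightarrow> \<exists>y\<in>Y - X. insert y X \<in> \<I>"

text \<open>The rank of a finite set; it only inspects independence of subsets of \<open>X\<close>.\<close>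

definition rank_of :: "'a set set \<Rightarrow> 'a set \<Rightarrow> nat" where
  "rank_of \<I> X = Max (card ` {Y. Y \<subseteq> X \<and> Y \<in> \<I>})"

text \<open>Only meaningful for elements of the ground set.\<close>

definition is_loop :: "'a set set \<Rightarrow> 'a \<Rightarrow> bool" where
  "is_loop \<I> e \<longleftrightarrow> {e} \<notin> \<I>"

definition weight :: "('a \<Rightarrow> real) \<Rightarrow> 'a set \<Rightarrow> real" where
  "weight \<omega> S = (\<Sum>e\<in>S. \<omega> e)"

definition select_first :: "'a set set \<Rightarrow> ('a \<Rightarrow> real) \<Rightarrow> real \<Rightarrow> 'a list \<Rightarrow> 'a set" where
  "select_first \<I> \<omega> L es =
     (case find (\<lambda>e. \<not> is_loop \<I> e \<and> L < \<omega> e) es of None \<Rightarrow> {} | Some e \<Rightarrow> {e})"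

text \<open>
  The adaptive threshold algorithm. The state consists of the set \<open>A\<close> of arrived elements, the set
  \<open>S\<close> of accepted elements, the next rank guess \<open>rs\<close> and the current threshold \<open>ws\<close>; the last
  argument lists the elements still to arrive. Whenever the rank of the arrived elements reaches
  \<open>rs\<close>, the guess is doubled; only the update of the threshold depends on the coin.
\<close>

primrec threshold_run ::
  "'a set set \<Rightarrow> ('a \<Rightarrow> real) \<Rightarrow> real \<Rightarrow> 'a set \<Rightarrow> 'a set \<Rightarrow> nat \<Rightarrow> real \<Rightarrow> 'a list \<Rightarrow> 'a set pmf"
where
  "threshold_run \<I> \<omega> L A S rs ws [] = return_pmf S"
| "threshold_run \<I> \<omega> L A S rs ws (e # es) =
     (let A' = insert e A;
          S' = (if ws < \<omega> e \<and> insert e S \<in> \<I> then insert e S else S)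
      in if rs \<le> rank_of \<I> A'
         then bind_pmf (bernoulli_pmf (1 / log 2 (2 * real rs)))
                (\<lambda>b. threshold_run \<I> \<omega> L A' S' (2 * rs)
                       (if b then L / (2 * real rs) else ws) es)
         else threshold_run \<I> \<omega> L A' S' rs ws es)"

definition algorithm :: "'a set set \<Rightarrow> ('a \<Rightarrow> real) \<Rightarrow> real \<Rightarrow> 'a list \<Rightarrow> 'a set pmf" where
  "algorithm \<I> \<omega> L es =
     bind_pmf (bernoulli_pmf (1 / 2))
       (\<lambda>b. if b then return_pmf (select_first \<I> \<omega> L es)
            else threshold_run \<I> \<omega> L {} {} 2 (L / 2) es)"

end

theory Submission
  imports Defs
begin

text \<open>
  With probability \<open>1/2\<close> the algorithm returns \<open>{e1}\<close>. Put \<open>T = OPT - {e1}\<close>; its weights are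
  below \<open>L\<close>. Let \<open>2 ^ N\<close> be the least power of two above \<open>r\<close>. The coin at rank \<open>2 ^ k\<close> has bias
  \<open>1 / (k + 1)\<close>, so the products telescope and the final threshold is uniformly distributed on
  \<open>L / 2 ^ j\<close>, \<open>1 \<le> j \<le> N\<close>. If \<open>L / 2 ^ j\<close> is final, the accepted set spans every element above
  this threshold that arrives after rank \<open>2 ^ (j - 1)\<close> is reached, hence it has weight at least
  \<open>L / 2 ^ j * a j - L / 2\<close>, where \<open>a j\<close> counts the elements of \<open>T\<close> heavier than \<open>L / 2 ^ j\<close>.
  Summing the geometric series for each element, \<open>\<Sum>j. L / 2 ^ j * a j\<close> is at least
  \<open>weight \<omega> T - L\<close>, and the losses, about \<open>L / 2\<close> on average, are paid for by \<open>e1\<close>.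
\<close>

lemma expectation_bernoulli_bind:
  fixes h :: "'a \<Rightarrow> real"
  assumes "0 \<le> p" "p \<le> 1" "\<And>b. finite (set_pmf (f b))"
  shows "measure_pmf.expectation (bind_pmf (bernoulli_pmf p) f) h =
    p * measure_pmf.expectation (f True) h + (1 - p) * measure_pmf.expectation (f False) h"
  using assms by (subst pmf_expectation_bind[where A = UNIV]) (auto simp: UNIV_bool)

context matroid
begin

section \<open>Rank and augmentation in a matroid\<close>

lemma finite_indep: "X \<in> \<I> \<Longrightarrow> finite X"
  using finite_ground finite_subset indep_subset_ground by blast

lemma finite_indep_family: "finite {Y. Y \<subseteq> A \<and> Y \<in> \<I>}"
  by (rule finite_subset[of _ "Pow E"]) (use finite_ground indep_subset_ground in auto)

lemma card_le_rank_of: "Y \<subseteq> A \<Longrightarrow> Y \<in> \<I> \<Longrightarrow> card Y \<le> rank_of \<I> A"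
  unfolding rank_of_def by (rule Max_ge) (auto simp: finite_indep_family)

lemma rank_of_leI:
  assumes "\<And>Y. Y \<subseteq> A \<Longrightarrow> Y \<in> \<I> \<Longrightarrow> card Y \<le> n"
  shows "rank_of \<I> A \<le> n"
  unfolding rank_of_def using assms indep_empty
  by (subst Max_le_iff) (auto simp: finite_indep_family)

lemma rank_of_mono: "A \<subseteq> B \<Longrightarrow> rank_of \<I> A \<le> rank_of \<I> B"
  by (meson card_le_rank_of order_trans rank_of_leI)

lemma rank_of_insert_le: "rank_of \<I> (insert e A) \<le> Suc (rank_of \<I> A)"
proof (rule rank_of_leI)
  fix Y assume Y: "Y \<subseteq> insert e A" "Y \<in> \<I>"
  have "card (Y - {e}) \<le> rank_of \<I> A"
    using Y indep_hereditary[of Y "Y - {e}"] by (intro card_le_rank_of) auto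
  moreover have "card Y \<le> Suc (card (Y - {e}))"
    by (auto simp: card_Diff_singleton_if)
  ultimately show "card Y \<le> Suc (rank_of \<I> A)" by linarith
qed

text \<open>If \<open>S\<close> were smaller, augmentation would move some element of
  \<open>X - S\<close> into it, which the last hypothesis excludes.\<close>

lemma card_le_if_spanned:
  assumes "X \<in> \<I>" "S \<in> \<I>" "\<And>x. x \<in> X \<Longrightarrow> x \<in> S \<or> insert x S \<notin> \<I>"
  shows "card X \<le> card S"
  using indep_augment[of S X] assms by force

section \<open>Runs of the threshold algorithm\<close>

lemma finite_set_pmf_threshold_run:
  "finite (set_pmf (threshold_run \<I> \<omega> L A S rs ws es))"
  by (induction es arbitrary: A S rs ws) (auto simp: Let_def)

lemma threshold_run_indep:
  assumes "U \<in> set_pmf (threshold_run \<I> \<omega> L A S rs ws es)" "S \<in> \<I>"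
  shows "U \<in> \<I>"
  using assms by (induction es arbitrary: A S rs ws) (auto simp: Let_def split: if_splits)

text \<open>
  From a state with guess \<open>2 ^ k\<close>, the current threshold \<open>ws\<close> is final with probability \<open>k / N\<close> and
  each later \<open>L / 2 ^ j\<close> with probability \<open>1 / N\<close>. If \<open>ws\<close> is final, the result spans \<open>X\<close>.
\<close>

lemma threshold_run_expectation_ge:
  fixes ws :: real
  assumes L: "0 < L" and T: "T \<in> \<I>"
    and N: "rank_of \<I> E < 2 ^ N" "2 ^ N \<le> 2 * rank_of \<I> E"
    and "A \<union> set es = E" "S \<in> \<I>" "1 \<le> k" "k \<le> N" "rank_of \<I> A < 2 ^ k"
    and "L / 2 ^ k \<le> ws" "\<And>x. x \<in> S \<Longrightarrow> ws \<le> \<omega> x"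
    and "X \<in> \<I>" "\<And>x. x \<in> X \<Longrightarrow> x \<in> S \<or> insert x S \<notin> \<I> \<or> (x \<in> set es \<and> ws < \<omega> x)"
  shows "real k / N * (ws * card X)
           + (\<Sum>j=Suc k..N. L / 2 ^ j * card {x \<in> T. L / 2 ^ j < \<omega> x} - L / 2) / N
         \<le> measure_pmf.expectation (threshold_run \<I> \<omega> L A S (2 ^ k) ws es) (weight \<omega>)"
  using assms(5-)
proof (induction es arbitrary: A S k ws X)
  case Nil
  \<comment> \<open>Now \<open>A = E\<close>, so the rank of \<open>E\<close> is below
    \<open>2 ^ k\<close>. Every guess has been passed: the sum is empty and \<open>k / N\<close> is
    1.\<close>
  have "(2::nat) ^ N < 2 ^ Suc k" using Nil.prems(1,5) N(2) by simp
  hence "N < Suc k" by (rule power_less_imp_less_exp[rotated]) simp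
  hence k: "k = N" using Nil.prems(4) by simp
  have "card X \<le> card S"
    using Nil.prems by (intro card_le_if_spanned) auto
  moreover have "0 \<le> ws" using Nil.prems(6) L by (smt (verit) divide_pos_pos zero_less_power)
  ultimately have "ws * card X \<le> ws * card S" by (intro mult_left_mono) auto
  also have "\<dots> \<le> weight \<omega> S"
    using sum_bounded_below[of S ws \<omega>] Nil.prems(7) by (simp add: weight_def mult.commute)
  finally show ?case using k Nil.prems(3) by simp
next
  case (Cons e es)
  define A' where "A' = insert e A"
  define S' where "S' = (if ws < \<omega> e \<and> insert e S \<in> \<I> then insert e S else S)"
  define b where "b j = L / 2 ^ j * card {x \<in> T. L / 2 ^ j < \<omega> x} - L / 2" for j
  let ?E = "\<lambda>k ws. measure_pmf.expectation (threshold_run \<I> \<omega> L A' S' (2 ^ k) ws es) (weight \<omega>)"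
  have ground: "A' \<union> set es = E" using Cons.prems(1) by (auto simp: A'_def)
  have S': "S' \<in> \<I>" using Cons.prems(2) by (auto simp: S'_def)
  have S'_ge: "ws \<le> \<omega> x" if "x \<in> S'" for x
    using that Cons.prems(7) by (auto simp: S'_def split: if_splits)
  have S_sub: "S \<subseteq> S'" by (auto simp: S'_def)
  have mono: "insert x S \<notin> \<I> \<Longrightarrow> insert x S' \<notin> \<I>" for x
    using indep_hereditary[of "insert x S'" "insert x S"] S_sub by blast
  \<comment> \<open>Only \<open>x = e\<close> changes status: if heavier than \<open>ws\<close>, it
    is either accepted or dependent on \<open>S' = S\<close>.\<close>
  have X: "x \<in> S' \<or> insert x S' \<notin> \<I> \<or> (x \<in> set es \<and> ws < \<omega> x)" if "x \<in> X" for x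
    using Cons.prems(9)[OF that] mono[of x] by (auto simp: S'_def)
  show ?case
  proof (cases "2 ^ k \<le> rank_of \<I> A'")
    case False
    have "real k / N * (ws * card X) + (\<Sum>j=Suc k..N. b j) / N \<le> ?E k ws"
      unfolding b_def
      by (rule Cons.IH[OF ground S' Cons.prems(3,4) _ Cons.prems(6) S'_ge Cons.prems(8) X])
        (use False in auto)
    thus ?thesis using False by (simp add: Let_def A'_def S'_def b_def)
  next
    case True
    \<comment> \<open>The rank grows by at most one per arrival, so a guess is met exactly: one
      doubling suffices, and at most \<open>2 ^ k\<close> independent elements have arrived.\<close>
    have rank_A': "rank_of \<I> A' \<le> 2 ^ k"
      using rank_of_insert_le[of e A] Cons.prems(5) by (simp add: A'_def)
    have "rank_of \<I> A' \<le> rank_of \<I> E" using ground by (intro rank_of_mono) auto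
    hence "(2::nat) ^ k < 2 ^ N" using True N(1) by linarith
    hence kN: "Suc k \<le> N" by (simp add: Suc_leI)
    have k1: "1 \<le> Suc k" and rank_A'2: "rank_of \<I> A' < 2 ^ Suc k"
      using rank_A' by (auto intro: le_less_trans)
    have half: "L / 2 ^ Suc k \<le> L / 2 ^ k" using L by (simp add: field_simps)
    have keep: "real (Suc k) / N * (ws * card X) + (\<Sum>j=Suc (Suc k)..N. b j) / N \<le> ?E (Suc k) ws"
      unfolding b_def
      by (rule Cons.IH[OF ground S' k1 kN rank_A'2 _ S'_ge Cons.prems(8) X])
        (use half Cons.prems(6) in auto)
    define t where "t = L / 2 ^ Suc k"
    define H where "H = {x \<in> T. t < \<omega> x}"
    \<comment> \<open>If the threshold drops to \<open>t\<close>, spanning restarts with the part of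
      \<open>H\<close> still to arrive; each of its elements will be tested against \<open>t\<close>
      or a lower threshold.\<close>
    define Y where "Y = H - A'"
    have H: "H \<in> \<I>" using T by (rule indep_hereditary) (auto simp: H_def)
    have Y: "Y \<in> \<I>" using H by (rule indep_hereditary) (auto simp: Y_def)
    have change: "real (Suc k) / N * (t * card Y) + (\<Sum>j=Suc (Suc k)..N. b j) / N \<le> ?E (Suc k) t"
      unfolding b_def
    proof (rule Cons.IH[OF ground S' k1 kN rank_A'2 _ _ Y])
      show "t \<le> \<omega> x" if "x \<in> S'" for x
        using S'_ge[OF that] Cons.prems(6) half by (simp add: t_def)
      show "x \<in> S' \<or> insert x S' \<notin> \<I> \<or> (x \<in> set es \<and> t < \<omega> x)" if "x \<in> Y" for x
        using that ground indep_subset_ground[OF T] by (auto simp: Y_def H_def)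
    qed (simp add: t_def)
    \<comment> \<open>The arrived part of \<open>H\<close> is independent, hence has at most
      \<open>2 ^ k\<close> elements. Giving it up costs at most \<open>t * 2 ^ k = L / 2\<close>,
      the loss subtracted in \<open>b\<close>.\<close>
    have "card (H \<inter> A') \<le> rank_of \<I> A'"
      using H by (intro card_le_rank_of) (auto intro: indep_hereditary)
    moreover have "card H = card (H \<inter> A') + card Y"
      unfolding Y_def using finite_indep[OF H] by (metis card_Diff_subset_Int card_mono
          add.commute le_add_diff_inverse2 finite_Int inf_le1)
    ultimately have "card H \<le> 2 ^ k + card Y" using rank_A' by linarith
    hence "real (card H) \<le> 2 ^ k + card Y" by (metis of_nat_add of_nat_le_iff of_nat_numeral of_nat_power)
    hence "t * card H \<le> t * (2 ^ k + card Y)" using L by (intro mult_left_mono) (auto simp: t_def)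
    moreover have "t * 2 ^ k = L / 2" by (simp add: t_def)
    moreover have "b (Suc k) = t * card H - L / 2" by (simp add: b_def H_def t_def)
    ultimately have b: "b (Suc k) \<le> t * card Y" by (simp add: distrib_left)
    define p where "p = 1 / (real k + 1)"
    have p: "0 \<le> p" "p \<le> 1" by (auto simp: p_def)
    have "1 / log 2 (2 * real (2 ^ k)) = p"
      using log_pow_cancel[of 2 "Suc k"] by (simp add: p_def add.commute)
    hence run: "measure_pmf.expectation (threshold_run \<I> \<omega> L A S (2 ^ k) ws (e # es)) (weight \<omega>)
       = p * ?E (Suc k) t + (1 - p) * ?E (Suc k) ws"
      using True p
      by (simp add: Let_def A'_def[symmetric] S'_def[symmetric] t_def
          expectation_bernoulli_bind finite_set_pmf_threshold_run)
    have "real k / N * (ws * card X) + (\<Sum>j=Suc k..N. b j) / N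
        = (1 - p) * (real (Suc k) / N * (ws * card X)) + p * (real (Suc k) / N * b (Suc k))
          + (\<Sum>j=Suc (Suc k)..N. b j) / N"
    proof -
      \<comment> \<open>This is the telescoping: after the coin, the current threshold has share
        \<open>(k + 1) / N\<close>; \<open>1 - p\<close> scales it to \<open>k / N\<close> and
        \<open>p\<close> to \<open>1 / N\<close>.\<close>
      have "(1 - p) * real (Suc k) = k" "p * real (Suc k) = 1"
        by (auto simp: p_def field_simps)
      hence "(1 - p) * (real (Suc k) / N * y) = real k / N * y" "p * (real (Suc k) / N * y) = y / N" for y
        by (simp_all only: times_divide_eq_right times_divide_eq_left mult_1_left flip: mult.assoc)
      moreover have "(\<Sum>j=Suc k..N. b j) = b (Suc k) + (\<Sum>j=Suc (Suc k)..N. b j)"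
        using kN by (rule sum.atLeast_Suc_atMost)
      ultimately show ?thesis by (simp only: add_divide_distrib add.assoc)
    qed
    also have "\<dots> \<le> (1 - p) * (real (Suc k) / N * (ws * card X)) + p * (real (Suc k) / N * (t * card Y))
          + (\<Sum>j=Suc (Suc k)..N. b j) / N"
      using b p by (intro order_refl add_mono mult_left_mono) auto
    also have "\<dots> = p * (real (Suc k) / N * (t * card Y) + (\<Sum>j=Suc (Suc k)..N. b j) / N)
        + (1 - p) * (real (Suc k) / N * (ws * card X) + (\<Sum>j=Suc (Suc k)..N. b j) / N)"
      by algebra
    also have "\<dots> \<le> p * ?E (Suc k) t + (1 - p) * ?E (Suc k) ws"
      using change keep p by (intro add_mono mult_left_mono) auto
    finally show ?thesis unfolding run b_def .
  qed
qed

end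

text \<open>If \<open>i\<close> is the first index with \<open>L / 2 ^ i < w\<close>, the terms from
  \<open>i\<close> on sum to \<open>L / 2 ^ (i - 1) - L / 2 ^ n\<close>, and
  \<open>w \<le> L / 2 ^ (i - 1)\<close>. In the induction, a new term either halves the error or
  has \<open>w \<le> L / 2 ^ Suc n\<close>.\<close>

lemma dyadic_sum_ge:
  fixes w L :: real
  assumes "0 \<le> L" "w \<le> L"
  shows "w - L / 2 ^ n \<le> (\<Sum>j=1..n. if L / 2 ^ j < w then L / 2 ^ j else 0)"
proof (induction n)
  case (Suc n)
  have "0 \<le> (\<Sum>j=1..n. if L / 2 ^ j < w then L / 2 ^ j else 0)"
    using assms(1) by (intro sum_nonneg) auto
  moreover have "L / 2 ^ n = L / 2 ^ Suc n + L / 2 ^ Suc n" by simp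
  ultimately show ?case using Suc by (auto simp del: power_Suc)
qed (use assms in simp)

theorem theorem2:
  fixes E :: "'a set" and \<I> :: "'a set set" and \<omega> :: "'a \<Rightarrow> real" and L :: real
    and es :: "'a list" and r :: nat and e1 e2 :: 'a and OPT :: "'a set"
  assumes "matroid E \<I>"
    and "rank_of \<I> E = r"
    and "distinct es" and "set es = E"
    and "\<And>e. e \<in> E \<Longrightarrow> 0 \<le> \<omega> e"
    and "is_arg_max \<omega> (\<lambda>e. e \<in> E \<and> \<not> is_loop \<I> e) e1"
    and "is_arg_max \<omega> (\<lambda>e. e \<in> E \<and> \<not> is_loop \<I> e \<and> e \<noteq> e1) e2"
    and "\<omega> e2 < L" and "L < \<omega> e1"
    and "is_arg_max (weight \<omega>) (\<lambda>S. S \<in> \<I>) OPT"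
  shows "measure_pmf.expectation (algorithm \<I> \<omega> L es) (weight \<omega>)
           \<ge> 1 / (16 * log 2 (real r)) * weight \<omega> OPT"
proof -
  interpret matroid E \<I> by fact
  note nonneg = assms(5)
  have e1: "e1 \<in> E" "{e1} \<in> \<I>" using assms(6) by (auto simp: is_arg_max_def is_loop_def)
  have e2: "e2 \<in> E" using assms(7) by (auto simp: is_arg_max_def)
  have L: "0 < L" using nonneg[OF e2] assms(8) by linarith
  have below: "\<omega> x < L" if "x \<in> E" "{x} \<in> \<I>" "x \<noteq> e1" for x
    using assms(7,8) that by (force simp: is_arg_max_def is_loop_def)
  have OPT: "OPT \<in> \<I>" using assms(10) by (auto simp: is_arg_max_def)
  have r1: "1 \<le> r" using card_le_rank_of[of "{e1}" E] e1 assms(2) by simp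

  \<comment> \<open>The two branches of the algorithm\<close>
  let ?R = "threshold_run \<I> \<omega> L {} {} 2 (L / 2) es"
  define ET where "ET = measure_pmf.expectation ?R (weight \<omega>)"
  have select: "select_first \<I> \<omega> L es = {e1}"
  proof -
    have "\<exists>e. find (\<lambda>e. \<not> is_loop \<I> e \<and> L < \<omega> e) es = Some e"
      using e1 assms(4,9) by (cases "find (\<lambda>e. \<not> is_loop \<I> e \<and> L < \<omega> e) es")
        (auto simp: find_None_iff is_loop_def)
    then obtain e where e: "find (\<lambda>e. \<not> is_loop \<I> e \<and> L < \<omega> e) es = Some e" by blast
    hence "e \<in> E" "{e} \<in> \<I>" "L < \<omega> e"
      using assms(4) by (auto simp: find_Some_iff is_loop_def)
    with below[of e] have "e = e1" by fastforce
    thus ?thesis using e by (simp add: select_first_def)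
  qed
  have alg: "measure_pmf.expectation (algorithm \<I> \<omega> L es) (weight \<omega>) = \<omega> e1 / 2 + ET / 2"
    by (simp add: algorithm_def expectation_bernoulli_bind
        finite_set_pmf_threshold_run select ET_def weight_def)

  show ?thesis
  proof (cases "r = 1")
    case True
    have "0 \<le> ET" unfolding ET_def
    proof (intro integral_nonneg_AE AE_pmfI)
      fix U assume "U \<in> set_pmf ?R"
      hence "U \<subseteq> E" using threshold_run_indep indep_empty indep_subset_ground by blast
      thus "0 \<le> weight \<omega> U" unfolding weight_def using nonneg by (intro sum_nonneg) auto
    qed
    \<comment> \<open>here \<open>log 2 1 = 0\<close>, and the claimed bound is \<open>1 / 0 * weight \<omega> OPT = 0\<close>\<close>
    thus ?thesis using True alg nonneg[OF e1(1)] by simp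
  next
    case False
    \<comment> \<open>\<open>K\<close> is the integer part of \<open>log 2 r\<close>, so
      \<open>2 ^ (K + 1)\<close> lies above \<open>r\<close> but not above
      \<open>2 * r\<close>.\<close>
    obtain K where K: "2 ^ K \<le> r" "r < 2 ^ (K + 1)"
      using ex_power_ivl1[of 2 r] r1 by auto
    have K1: "1 \<le> K" using K(2) False r1 by (cases K) auto
    define N where "N = K + 1"
    define T where "T = OPT - {e1}"
    define a where "a j = card {x \<in> T. L / 2 ^ j < \<omega> x}" for j
    have T: "T \<in> \<I>" using OPT by (rule indep_hereditary) (auto simp: T_def)
    have finT: "finite T" using finite_indep[OF T] .
    have cardT: "card T \<le> r" using card_le_rank_of[OF indep_subset_ground[OF T] T] assms(2) by simp
    have T_le: "\<omega> x \<le> L" if "x \<in> T" for x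
      using that below[of x] indep_subset_ground[OF T] indep_hereditary[OF T, of "{x}"]
      by (force simp: T_def)
    \<comment> \<open>The initial threshold \<open>L / 2\<close> is the case \<open>j = 1\<close>.
      It applies before any arrival, so it incurs no loss, and only \<open>K\<close> losses of
      \<open>L / 2\<close> remain.\<close>
    have "real 1 / N * (L / 2 * card {x \<in> T. L / 2 < \<omega> x})
           + (\<Sum>j=Suc 1..N. L / 2 ^ j * card {x \<in> T. L / 2 ^ j < \<omega> x} - L / 2) / N
         \<le> measure_pmf.expectation (threshold_run \<I> \<omega> L {} {} (2 ^ 1) (L / 2) es) (weight \<omega>)"
    proof (rule threshold_run_expectation_ge[OF L T])
      show "{x \<in> T. L / 2 < \<omega> x} \<in> \<I>" using T by (rule indep_hereditary) auto
      show "rank_of \<I> {} < 2 ^ 1" using rank_of_leI[of "{}" 0] by simp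
    qed (use K indep_subset_ground[OF T] indep_empty assms(2,4) in \<open>auto simp: N_def\<close>)
    hence "(L / 2 ^ 1 * a 1 + (\<Sum>j=Suc 1..N. L / 2 ^ j * a j - L / 2)) / N \<le> ET"
      by (simp add: ET_def a_def add_divide_distrib)
    hence "L / 2 ^ 1 * a 1 + (\<Sum>j=Suc 1..N. L / 2 ^ j * a j - L / 2) \<le> N * ET"
      by (simp add: N_def field_simps)
    moreover have "(\<Sum>j=1..N. L / 2 ^ j * a j) = L / 2 ^ 1 * a 1 + (\<Sum>j=Suc 1..N. L / 2 ^ j * a j)"
      by (rule sum.atLeast_Suc_atMost) (simp add: N_def)
    ultimately have run: "(\<Sum>j=1..N. L / 2 ^ j * a j) - K * (L / 2) \<le> N * ET"
      by (simp add: sum_subtractf N_def)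
    \<comment> \<open>The truncation errors \<open>L / 2 ^ N\<close> of at most \<open>2 ^ N\<close>
      elements add up to at most \<open>L\<close>.\<close>
    have "weight \<omega> T - L \<le> weight \<omega> T - card T * (L / 2 ^ N)"
    proof -
      have "card T \<le> 2 ^ N" using cardT K(2) by (simp add: N_def)
      hence "real (card T) \<le> 2 ^ N" by simp
      thus ?thesis using L mult_right_mono[of "real (card T)" "2 ^ N" "L / 2 ^ N"] by simp
    qed
    also have "\<dots> = (\<Sum>x\<in>T. \<omega> x - L / 2 ^ N)" by (simp add: weight_def sum_subtractf)
    also have "\<dots> \<le> (\<Sum>x\<in>T. \<Sum>j=1..N. if L / 2 ^ j < \<omega> x then L / 2 ^ j else 0)"
      using L T_le by (intro sum_mono dyadic_sum_ge) auto
    also have "\<dots> = (\<Sum>j=1..N. \<Sum>x\<in>T. if L / 2 ^ j < \<omega> x then L / 2 ^ j else 0)"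
      by (rule sum.swap)
    also have "\<dots> = (\<Sum>j=1..N. L / 2 ^ j * a j)"
      using finT by (simp add: a_def mult.commute flip: sum.inter_filter)
    finally have "weight \<omega> T - L - K * (L / 2) \<le> N * ET" using run by linarith
    moreover have "L + K * (L / 2) \<le> \<omega> e1 + K * \<omega> e1 / 2"
      using assms(9) mult_left_mono[of L "\<omega> e1" "1 + K / 2"] by (simp add: algebra_simps)
    moreover have "\<omega> e1 \<le> K * \<omega> e1"
      using K1 nonneg[OF e1(1)] mult_right_mono[of 1 "real K" "\<omega> e1"] by simp
    moreover have "weight \<omega> OPT \<le> \<omega> e1 + weight \<omega> T"
      using nonneg[OF e1(1)] finite_indep[OF OPT]
      by (simp add: T_def weight_def sum_diff1)
    \<comment> \<open>With the bound on \<open>N * ET\<close>, this limits how negative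
      \<open>ET\<close> could be, so \<open>ET\<close> may be counted twice in the target.\<close>
    moreover have "0 \<le> weight \<omega> T"
      unfolding weight_def using nonneg indep_subset_ground[OF T] by (intro sum_nonneg) auto
    moreover have "4 * N * (\<omega> e1 / 2 + ET / 2) = 2 * (N * ET) + 2 * (K * \<omega> e1) + 2 * \<omega> e1"
      by (simp add: N_def algebra_simps)
    ultimately have main: "weight \<omega> OPT \<le> 4 * N * (\<omega> e1 / 2 + ET / 2)"
      by linarith
    have "real K \<le> log 2 r" using K(1) r1 by (simp add: le_log_iff powr_realpow flip: of_nat_le_iff)
    \<comment> \<open>Since \<open>1 \<le> K\<close>, \<open>N = K + 1 \<le> 2 * K\<close>; even
      \<open>8 * log 2 r\<close> would bound \<open>4 * N\<close>.\<close>
    hence log: "4 * real N \<le> 16 * log 2 r" "0 < log 2 r" using K1 by (auto simp: N_def)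
    have "0 \<le> weight \<omega> OPT"
      unfolding weight_def using nonneg indep_subset_ground[OF OPT] by (intro sum_nonneg) auto
    with main have "0 \<le> 4 * N * (\<omega> e1 / 2 + ET / 2)" by linarith
    hence "0 \<le> \<omega> e1 / 2 + ET / 2" by (simp add: zero_le_mult_iff N_def)
    from mult_right_mono[OF log(1) this] main
    have "weight \<omega> OPT \<le> 16 * log 2 r * (\<omega> e1 / 2 + ET / 2)" by simp
    thus ?thesis using log(2) unfolding alg by (simp add: field_simps)
  qed
qed

end
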